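(* Let $1\leq p<\infty$, $0<\kappa<1$ and $n\in\mathbb N$. If $f\in L^{p,\kappa}(\mathbb R^n)\cap L^\infty(\mathbb R^n)$, then for every $q$ with $p<q<\infty$ we have $f\in L^{q,\kappa}(\mathbb R^n)$, and $$\|f\|_{L^{q,\kappa}}\leq \big(\|f\|_{L^{p,\kappa}}\big)^{p/q}\cdot\big(\|f\|_{L^\infty}\big)^{1-p/q}.$$
   Context: $\mathbb R^n$ carries Lebesgue measure, and $|E|$ denotes the Lebesgue measure of $E\subset\mathbb R^n$. Cubes have sides parallel to the coordinate axes. For $1\leq p<\infty$ and $0\leq\kappa\leq1$, the Morrey space $L^{p,\kappa}(\mathbb R^n)$ is the set of locally integrable functions $f$ on $\mathbb R^n$ such that $$\|f\|_{L^{p,\kappa}}:=\sup_{Q\subset\mathbb R^n}\bigg(\frac{1}{|Q|^{\kappa}}\int_{Q}|f(y)|^p\,dy\bigg)^{1/p}<+\infty,$$ where the supremum is taken over all cubes $Q$ in $\mathbb R^n$. $\|f\|_{L^\infty}$ is the essential supremum of $|f|$ over $\mathbb R^n$, and $L^\infty(\mathbb R^n)$ is the set of measurable functions for which it is finite. *)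

theory Defs
  imports "HOL-Analysis.Analysis" "HOL-Probability.Essential_Supremum"
begin

text \<open>Closed cubes with sides parallel to the axes and positive side length; open or half-open
  cubes differ from these by null sets.\<close>

definition cubes :: "(real ^ 'n) set set" where
  "cubes = {cbox a (a + (\<chi> i. l)) | a l. 0 < l}"

text \<open>Powers of extended nonnegative reals, intended for exponents \<open>a > 0\<close> only.\<close>

definition epowr :: "ennreal \<Rightarrow> real \<Rightarrow> ennreal" where
  "epowr x a = (if x = \<infinity> then \<infinity> else ennreal (enn2real x powr a))"

definition locally_integrable :: "(real ^ 'n \<Rightarrow> complex) \<Rightarrow> bool" where
  "locally_integrable f \<longleftrightarrow> (\<forall>K. compact K \<longrightarrow> f absolutely_integrable_on K)"

text \<open>Functions are not identified up to null sets. The norms take values in \<open>[0, \<infinity>]\<close>, so that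
  finiteness is a genuine condition.\<close>

definition morrey_norm :: "real \<Rightarrow> real \<Rightarrow> (real ^ 'n \<Rightarrow> complex) \<Rightarrow> ennreal" where
  "morrey_norm p \<kappa> f =
    (SUP Q\<in>cubes. epowr ((\<integral>\<^sup>+y\<in>Q. ennreal (norm (f y) powr p) \<partial>lebesgue)
                          / ennreal (measure lebesgue Q powr \<kappa>)) (1 / p))"

definition morrey_space :: "real \<Rightarrow> real \<Rightarrow> (real ^ 'n \<Rightarrow> complex) set" where
  "morrey_space p \<kappa> = {f. locally_integrable f \<and> morrey_norm p \<kappa> f < \<infinity>}"

definition Linf_norm :: "(real ^ 'n \<Rightarrow> complex) \<Rightarrow> ennreal" where
  "Linf_norm f = esssup lebesgue (\<lambda>x. ennreal (norm (f x)))"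

definition Linf_space :: "(real ^ 'n \<Rightarrow> complex) set" where
  "Linf_space = {f. f \<in> borel_measurable lebesgue \<and> Linf_norm f < \<infinity>}"

end

theory Submission
  imports Defs
begin

text \<open>The inequality interpolates between the Morrey norm and the essential supremum. For almost
  every \<open>y\<close> one has \<open>|f y| \<le> M\<close> with \<open>M = \<parallel>f\<parallel>\<^sub>\<infinity>\<close>, hence
  \<open>|f y|\<^sup>q = |f y|\<^sup>q\<^sup>-\<^sup>p |f y|\<^sup>p \<le> M\<^sup>q\<^sup>-\<^sup>p |f y|\<^sup>p\<close>. Integrating over a cube \<open>Q\<close> and dividing by
  \<open>|Q|\<^sup>\<kappa>\<close> bounds the \<open>q\<close>-average over \<open>Q\<close> by \<open>M\<^sup>q\<^sup>-\<^sup>p\<close> times the \<open>p\<close>-average (lemma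
  \<open>morrey_average_interpolation\<close>). Taking \<open>q\<close>-th roots turns \<open>M\<^sup>q\<^sup>-\<^sup>p\<close> into \<open>M\<close> to the power
  \<open>1 - p/q\<close>, and the \<open>q\<close>-th root of the \<open>p\<close>-average into the power \<open>p/q\<close> of its \<open>p\<close>-th root. That
  root is at most the Morrey norm, so the bound does not depend on \<open>Q\<close> and survives the supremum.\<close>

lemma epowr_less_top_iff: "epowr x a < top \<longleftrightarrow> x < top"
  by (simp add: epowr_def less_top)

lemma epowr_mono:
  assumes "x \<le> y" "0 \<le> a"
  shows "epowr x a \<le> epowr y a"
proof (cases "y = \<infinity>")
  case False
  then have "x \<noteq> \<infinity>" using assms(1) by (auto simp: top_unique)
  moreover have "enn2real x \<le> enn2real y"
    using False assms(1) by (simp add: enn2real_mono top.not_eq_extremum)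
  ultimately show ?thesis
    using False assms(2) by (simp add: epowr_def ennreal_leI powr_mono2)
qed (simp add: epowr_def)

lemma epowr_epowr: "epowr (epowr x a) b = epowr x (a * b)"
  by (simp add: epowr_def powr_powr)

text \<open>Infinite factors do no harm: \<open>\<infinity> * 0 = 0\<close> in \<open>[0, \<infinity>]\<close>, and the real power of \<open>0\<close> is \<open>0\<close> for
  every exponent, so both sides vanish together.\<close>

lemma epowr_mult: "epowr (x * y) a = epowr x a * epowr y a"
  by (cases x; cases y)
    (auto simp: epowr_def ennreal_mult_eq_top_iff ennreal_mult_top ennreal_top_mult
      enn2real_mult powr_mult simp flip: ennreal_mult)

lemma AE_norm_le_Linf_norm:
  assumes "f \<in> Linf_space"
  shows "AE y in lebesgue. norm (f y) \<le> enn2real (Linf_norm f)"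
proof -
  have [measurable]: "f \<in> borel_measurable lebesgue" and fin: "Linf_norm f < \<infinity>"
    using assms by (auto simp: Linf_space_def)
  have "AE y in lebesgue. ennreal (norm (f y)) \<le> Linf_norm f"
    unfolding Linf_norm_def by (rule esssup_AE)
  then show ?thesis
  proof eventually_elim
    case (elim y)
    then show ?case using enn2real_mono[OF elim] fin by simp
  qed
qed

text \<open>Pointwise, the excess \<open>q - p\<close> of the exponent is paid for by the essential supremum; the
  weight \<open>w\<close> stands for the normalising factor \<open>|Q|\<^sup>\<kappa>\<close>.\<close>

lemma morrey_average_interpolation:
  assumes f: "f \<in> Linf_space" and pq: "p \<le> q" and Q: "Q \<in> sets lebesgue"
  shows "(\<integral>\<^sup>+y\<in>Q. ennreal (norm (f y) powr q) \<partial>lebesgue) / w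
    \<le> epowr (Linf_norm f) (q - p) * ((\<integral>\<^sup>+y\<in>Q. ennreal (norm (f y) powr p) \<partial>lebesgue) / w)"
proof -
  define M where "M = enn2real (Linf_norm f)"
  have [measurable]: "f \<in> borel_measurable lebesgue"
    using f by (simp add: Linf_space_def)
  note [measurable] = Q
  have M: "epowr (Linf_norm f) (q - p) = ennreal (M powr (q - p))"
    using f by (auto simp: Linf_space_def epowr_def M_def)
  have "AE y in lebesgue. ennreal (norm (f y) powr q) * indicator Q y
      \<le> ennreal (M powr (q - p)) * (ennreal (norm (f y) powr p) * indicator Q y)"
    using AE_norm_le_Linf_norm[OF f]
  proof eventually_elim
    case (elim y)
    have "norm (f y) powr q = norm (f y) powr (q - p) * norm (f y) powr p"
      by (simp flip: powr_add)
    also have "\<dots> \<le> M powr (q - p) * norm (f y) powr p"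
      using elim pq by (intro mult_right_mono powr_mono2) (auto simp: M_def)
    finally show ?case
      by (auto simp: indicator_def ennreal_leI simp flip: ennreal_mult)
  qed
  then have "(\<integral>\<^sup>+y\<in>Q. ennreal (norm (f y) powr q) \<partial>lebesgue)
      \<le> (\<integral>\<^sup>+y. ennreal (M powr (q - p)) * (ennreal (norm (f y) powr p) * indicator Q y) \<partial>lebesgue)"
    by (rule nn_integral_mono_AE)
  also have "\<dots> = ennreal (M powr (q - p)) * (\<integral>\<^sup>+y\<in>Q. ennreal (norm (f y) powr p) \<partial>lebesgue)"
    by (rule nn_integral_cmult) measurable
  finally show ?thesis
    unfolding M ennreal_times_divide by (rule divide_right_mono_ennreal)
qed

theorem theorem2p7:
  fixes p \<kappa> :: real and f :: "real ^ 'n \<Rightarrow> complex"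
  assumes "1 \<le> p" and "0 < \<kappa>" and "\<kappa> < 1"
    and "f \<in> morrey_space p \<kappa> \<inter> Linf_space"
  shows "\<forall>q. p < q \<longrightarrow>
           f \<in> morrey_space q \<kappa> \<and>
           morrey_norm q \<kappa> f \<le> epowr (morrey_norm p \<kappa> f) (p / q) * epowr (Linf_norm f) (1 - p / q)"
proof (intro allI impI)
  fix q assume pq: "p < q"
  then have q: "0 < q" using assms(1) by linarith
  have f: "f \<in> Linf_space" and loc: "locally_integrable f"
    and N: "morrey_norm p \<kappa> f < \<infinity>" and L: "Linf_norm f < \<infinity>"
    using assms(4) by (auto simp: morrey_space_def Linf_space_def)
  let ?B = "epowr (morrey_norm p \<kappa> f) (p / q) * epowr (Linf_norm f) (1 - p / q)"
  define A where "A r Q = (\<integral>\<^sup>+y\<in>Q. ennreal (norm (f y) powr r) \<partial>lebesgue)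
    / ennreal (measure lebesgue Q powr \<kappa>)" for r Q
  have norm_eq: "morrey_norm r \<kappa> f = (SUP Q\<in>cubes. epowr (A r Q) (1 / r))" for r
    by (simp add: morrey_norm_def A_def)
  have bound: "morrey_norm q \<kappa> f \<le> ?B"
    unfolding norm_eq[of q]
  proof (rule SUP_least)
    fix Q :: "(real ^ 'n) set" assume Q: "Q \<in> cubes"
    then have Qm: "Q \<in> sets lebesgue" by (auto simp: cubes_def)
    have le_norm: "epowr (A p Q) (1 / p) \<le> morrey_norm p \<kappa> f"
      unfolding norm_eq[of p] using Q by (rule SUP_upper)
    have "A q Q \<le> epowr (Linf_norm f) (q - p) * A p Q"
      unfolding A_def using f pq Qm by (intro morrey_average_interpolation) auto
    then have "epowr (A q Q) (1 / q) \<le> epowr (epowr (Linf_norm f) (q - p) * A p Q) (1 / q)"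
      using q by (intro epowr_mono) auto
    also have "\<dots> = epowr (epowr (Linf_norm f) (q - p)) (1 / q) * epowr (A p Q) (1 / q)"
      by (rule epowr_mult)
    also have "epowr (epowr (Linf_norm f) (q - p)) (1 / q) = epowr (Linf_norm f) (1 - p / q)"
      using q by (simp add: epowr_epowr diff_divide_distrib)
    also have "epowr (A p Q) (1 / q) = epowr (epowr (A p Q) (1 / p)) (p / q)"
      using assms(1) by (simp add: epowr_epowr)
    also have "epowr (Linf_norm f) (1 - p / q) * \<dots> \<le> ?B"
      unfolding mult.commute[of "epowr (Linf_norm f) (1 - p / q)"]
      using le_norm q assms(1) by (intro mult_right_mono epowr_mono) auto
    finally show "epowr (A q Q) (1 / q) \<le> ?B" .
  qed
  have "?B < \<infinity>"
    using N L by (simp add: ennreal_mult_less_top epowr_less_top_iff)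
  with bound have "morrey_norm q \<kappa> f < \<infinity>" by (rule le_less_trans)
  with loc bound show "f \<in> morrey_space q \<kappa> \<and> morrey_norm q \<kappa> f \<le> ?B"
    by (simp add: morrey_space_def)
qed

end
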